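(* Let $\alpha$ be an irrational number, $k\ge 1$ an integer, and let $u$ and $v$ be two factors of the same length occurring in a Sturmian word of slope $\alpha$. Then $u \sim_k v$ if and only if $u$ and $v$ share a common prefix and a common suffix of length $\min\{|u|, k-1\}$ and $u \sim_1 v$. Moreover, if $2(k-1)\|\alpha\| > 1$, then $u\sim_k v$ if and only if $u$ and $v$ share a common prefix and a common suffix of length $\min\{|u|,k-1\}$.
   Context: $\|x\|$ denotes the distance from the real number $x$ to the nearest integer. A Sturmian word of slope $\alpha$ (irrational) and intercept $x\in[0,1)$ is the infinite binary word whose $n$-th letter ($n \ge 0$) is $0$ if $\{x+n\alpha\} \in [0,\{1-\alpha\})$ and $1$ otherwise (or with the analogous left-open convention), where $\{\cdot\}$ is the fractional part. For a word $u$ and nonempty word $w$, $|u|_w$ is the number of occurrences of $w$ as a factor of $u$. Two words $u,v$ are $k$-abelian equivalent, $u\sim_k v$, if $|u|_w=|v|_w$ for every nonempty word $w$ of length at most $k$; $\sim_1$ is abelian equivalence (same number of each letter). *)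

theory Defs
  imports Complex_Main "HOL-Library.Sublist"
begin

text \<open>Finite words are lists; infinite binary words are functions from positions to the
  letters \<open>0\<close> and \<open>1\<close>.\<close>

definition dist_nearest_int :: "real \<Rightarrow> real" where
  "dist_nearest_int x = \<bar>x - of_int (round x)\<bar>"

text \<open>The left-closed and left-open coding conventions. In the latter the circle is represented
  by \<open>(0, 1]\<close>, so a fractional part equal to \<open>0\<close> stands for the end point \<open>1\<close> and gets letter \<open>1\<close>.\<close>

definition sturmian_lower :: "real \<Rightarrow> real \<Rightarrow> nat \<Rightarrow> nat" where
  "sturmian_lower \<alpha> x n = (if frac (x + real n * \<alpha>) \<in> {0..<frac (1 - \<alpha>)} then 0 else 1)"

definition sturmian_upper :: "real \<Rightarrow> real \<Rightarrow> nat \<Rightarrow> nat" where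
  "sturmian_upper \<alpha> x n = (if frac (x + real n * \<alpha>) \<in> {0<..frac (1 - \<alpha>)} then 0 else 1)"

definition sturmian_word :: "real \<Rightarrow> (nat \<Rightarrow> nat) \<Rightarrow> bool" where
  "sturmian_word \<alpha> s \<longleftrightarrow>
     \<alpha> \<notin> \<rat> \<and> (\<exists>x. 0 \<le> x \<and> x < 1 \<and> (s = sturmian_lower \<alpha> x \<or> s = sturmian_upper \<alpha> x))"

definition factor_of :: "'a list \<Rightarrow> (nat \<Rightarrow> 'a) \<Rightarrow> bool" where
  "factor_of u s \<longleftrightarrow> (\<exists>i. u = map s [i..<i + length u])"

definition occurrences :: "'a list \<Rightarrow> 'a list \<Rightarrow> nat" where
  "occurrences u w = card {i. i + length w \<le> length u \<and> take (length w) (drop i u) = w}"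

definition k_abelian_equiv :: "nat \<Rightarrow> 'a list \<Rightarrow> 'a list \<Rightarrow> bool" where
  "k_abelian_equiv k u v \<longleftrightarrow>
     (\<forall>w. w \<noteq> [] \<and> length w \<le> k \<longrightarrow> occurrences u w = occurrences v w)"

definition share_prefix :: "nat \<Rightarrow> 'a list \<Rightarrow> 'a list \<Rightarrow> bool" where
  "share_prefix m u v \<longleftrightarrow> (\<exists>p. length p = m \<and> prefix p u \<and> prefix p v)"

definition share_suffix :: "nat \<Rightarrow> 'a list \<Rightarrow> 'a list \<Rightarrow> bool" where
  "share_suffix m u v \<longleftrightarrow> (\<exists>p. length p = m \<and> suffix p u \<and> suffix p v)"

end

theory Submission
  imports Defs
begin

text \<open>Write \<open>T i = \<lfloor>x + i \<alpha>\<rfloor>\<close> (or \<open>\<lceil>x + i \<alpha>\<rceil>\<close>). A factor \<open>w\<close> of length \<open>l\<close> codes an interval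
  of the circle with end points \<open>- a \<alpha>\<close> and \<open>- b \<alpha>\<close>, \<open>a, b \<le> l\<close>, so the indicator of its occurring at
  position \<open>i\<close> is \<open>T (i + a) - T (i + b)\<close> up to a constant. The number of occurrences in a long factor
  therefore telescopes to values of \<open>T\<close> near its two ends, and these are controlled by the prefix, the
  suffix and the abelian class. If \<open>2 (k - 1) \<parallel>\<alpha>\<parallel> > 1\<close>, the points \<open>j \<alpha>\<close>, \<open>0 \<le> j < k\<close>, leave only gaps
  shorter than \<open>1/2\<close> on the circle; the common prefix and the common suffix then determine the same
  nearest integer to the distance between the two factors, which forces abelian equivalence.\<close>

subsection \<open>Counting occurrences\<close>

text \<open>Truncated subtraction makes the sum empty when \<open>w\<close> is longer than
  \<open>u\<close>.\<close>

lemma occurrences_eq_sum: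
  "occurrences u w =
     (\<Sum>i<Suc (length u) - length w. of_bool (take (length w) (drop i u) = w))"
proof -
  have "{i. i + length w \<le> length u \<and> take (length w) (drop i u) = w} =
        {i \<in> {..<Suc (length u) - length w}. take (length w) (drop i u) = w}"
    by auto
  then show ?thesis
    by (simp add: occurrences_def sum.If_cases of_bool_def Int_def)
qed

text \<open>Every occurrence of \<open>x\<close> except one at the very end of \<open>u\<close>
  extends by exactly one letter to the right. The boundary term thus detects whether
  \<open>x\<close> is a suffix.\<close>

lemma occurrences_snoc:
  assumes "finite A" "set u \<subseteq> A" "length x \<le> length u"
  shows "occurrences u x =
    (\<Sum>a\<in>A. occurrences u (x @ [a])) + of_bool (drop (length u - length x) u = x)"
proof -
  let ?m = "length x" and ?n = "length u"
  have *: "of_bool (take ?m (drop i u) = x) =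
      (\<Sum>a\<in>A. of_bool (take (Suc ?m) (drop i u) = x @ [a]) :: nat)" if "i < ?n - ?m" for i
  proof -
    have "take (Suc ?m) (drop i u) = take ?m (drop i u) @ [u ! (i + ?m)]"
      using that by (simp add: take_Suc_conv_app_nth)
    moreover have "u ! (i + ?m) \<in> A"
      using that assms(2) by (meson less_diff_conv nth_mem subsetD)
    ultimately show ?thesis
      using assms(1) by (simp add: of_bool_conj flip: sum_distrib_left)
  qed
  have "occurrences u x =
      (\<Sum>i<?n - ?m. of_bool (take ?m (drop i u) = x)) + of_bool (drop (?n - ?m) u = x)"
    using assms(3) by (simp add: occurrences_eq_sum Suc_diff_le)
  also have "(\<Sum>i<?n - ?m. of_bool (take ?m (drop i u) = x) :: nat) =
      (\<Sum>i<?n - ?m. \<Sum>a\<in>A. of_bool (take (Suc ?m) (drop i u) = x @ [a]))"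
    using * by (intro sum.cong) auto
  also have "\<dots> = (\<Sum>a\<in>A. occurrences u (x @ [a]))"
    by (subst sum.swap) (simp add: occurrences_eq_sum)
  finally show ?thesis .
qed

text \<open>Mirror image: only an occurrence at the start has no letter before it, so the boundary
  term detects whether \<open>x\<close> is a prefix.\<close>

lemma occurrences_Cons:
  assumes "finite A" "set u \<subseteq> A" "length x \<le> length u"
  shows "occurrences u x =
    (\<Sum>a\<in>A. occurrences u (a # x)) + of_bool (take (length x) u = x)"
proof -
  let ?m = "length x" and ?n = "length u"
  have *: "of_bool (take ?m (drop (Suc i) u) = x) =
      (\<Sum>a\<in>A. of_bool (take (Suc ?m) (drop i u) = a # x) :: nat)" if "i < ?n - ?m" for i
  proof -
    have "take (Suc ?m) (drop i u) = u ! i # take ?m (drop (Suc i) u)"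
      using that by (simp flip: Cons_nth_drop_Suc)
    moreover have "u ! i \<in> A"
      using that assms(2) by (meson less_imp_diff_less nth_mem subsetD less_le_trans diff_le_self)
    ultimately show ?thesis
      using assms(1) by (simp add: of_bool_conj flip: sum_distrib_right)
  qed
  have "occurrences u x =
      of_bool (take ?m u = x) + (\<Sum>i<?n - ?m. of_bool (take ?m (drop (Suc i) u) = x))"
    using assms(3)
    by (simp add: occurrences_eq_sum Suc_diff_le sum.lessThan_Suc_shift del: sum.lessThan_Suc)
  also have "(\<Sum>i<?n - ?m. of_bool (take ?m (drop (Suc i) u) = x) :: nat) =
      (\<Sum>i<?n - ?m. \<Sum>a\<in>A. of_bool (take (Suc ?m) (drop i u) = a # x))"
    using * by (intro sum.cong) auto
  also have "\<dots> = (\<Sum>a\<in>A. occurrences u (a # x))"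
    by (subst sum.swap) (simp add: occurrences_eq_sum)
  finally show ?thesis by simp
qed

section \<open>Ends and letter counts of k-abelian equivalent words\<close>

lemma share_prefix_iff:
  assumes "m \<le> length u" "m \<le> length v"
  shows "share_prefix m u v \<longleftrightarrow> take m u = take m v"
  using assms unfolding share_prefix_def
  by (metis append_eq_conv_conj length_take min.absorb2 prefix_def take_is_prefix)

lemma share_suffix_iff:
  assumes "m \<le> length u" "length u = length v"
  shows "share_suffix m u v \<longleftrightarrow> drop (length u - m) u = drop (length u - m) v"
proof
  assume "share_suffix m u v"
  then obtain p u' v' where "length p = m" "u = u' @ p" "v = v' @ p"
    by (auto simp: share_suffix_def suffix_def)
  then show "drop (length u - m) u = drop (length u - m) v"
    using assms by simp
next
  assume "drop (length u - m) u = drop (length u - m) v"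
  then show "share_suffix m u v"
    unfolding share_suffix_def using assms
    by (intro exI[of _ "drop (length u - m) u"]) (metis suffix_drop length_drop diff_diff_cancel)
qed

lemma k_abelian_equiv_imp_eq:
  assumes "k_abelian_equiv k u v" "length u = length v" "length u \<le> k"
  shows "u = v"
proof (cases "u = []")
  case False
  then have "occurrences u u = occurrences v u"
    using assms by (simp add: k_abelian_equiv_def)
  then show ?thesis
    using assms(2) by (simp add: occurrences_eq_sum of_bool_def split: if_splits)
qed (use assms in simp)

text \<open>The counts of a word of length \<open>m\<close> and of its one-letter extensions agree
  in \<open>u\<close> and \<open>v\<close>, so the boundary terms of the extension identities agree
  too.\<close>

lemma k_abelian_equiv_imp_ends:
  assumes eq: "k_abelian_equiv (Suc m) u v" and len: "length u = length v" "m \<le> length u"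
  shows "take m u = take m v" "drop (length u - m) u = drop (length u - m) v"
proof -
  define A where "A = set u \<union> set v"
  have A: "finite A" "set u \<subseteq> A" "set v \<subseteq> A"
    by (auto simp: A_def)
  have occ: "occurrences u w = occurrences v w" if "w \<noteq> []" "length w \<le> Suc m" for w
    using eq that by (simp add: k_abelian_equiv_def)
  show "take m u = take m v"
  \<comment> \<open>\<open>k_abelian_equiv\<close> only counts nonempty words, so the empty end is
    treated apart.\<close>
  proof (cases "m = 0")
    case False
    define x where "x = take m u"
    have x: "length x = m" "x \<noteq> []"
      using False len by (auto simp: x_def)
    have "of_bool (take m u = x) = (of_bool (take m v = x) :: nat)"
      using occurrences_Cons[OF A(1,2), of x] occurrences_Cons[OF A(1,3), of x] x len
      by (simp add: occ)
    then show ?thesis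
      by (simp add: x_def of_bool_def split: if_splits)
  qed simp
  show "drop (length u - m) u = drop (length u - m) v"
  proof (cases "m = 0")
    case False
    define x where "x = drop (length u - m) u"
    have x: "length x = m" "x \<noteq> []"
      using False len by (auto simp: x_def)
    have "of_bool (drop (length u - m) u = x) = (of_bool (drop (length u - m) v = x) :: nat)"
      using occurrences_snoc[OF A(1,2), of x] occurrences_snoc[OF A(1,3), of x] x len
      by (simp add: occ)
    then show ?thesis
      by (simp add: x_def of_bool_def split: if_splits)
  qed (use len in simp)
qed

lemma occurrences_singleton: "occurrences u [a] = count_list u a"
proof -
  have "(\<Sum>i<length u. of_bool (take (Suc 0) (drop i u) = [a])) = count_list u a"
    by (induction u) (auto simp: sum.lessThan_Suc_shift simp del: sum.lessThan_Suc)
  then show ?thesis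
    by (simp add: occurrences_eq_sum)
qed

text \<open>For binary words the sum is the number of ones, the quantity that telescopes to an
  increment of \<open>T\<close>.\<close>

lemma k_abelian_equiv_imp_sum_list_eq:
  fixes u v :: "nat list"
  assumes "k_abelian_equiv k u v" "k \<ge> 1"
  shows "sum_list u = sum_list v"
proof -
  have "count_list u a = count_list v a" for a
    using assms by (simp add: k_abelian_equiv_def flip: occurrences_singleton)
  moreover have "sum_list w = (\<Sum>a\<in>set u \<union> set v. count_list w a * a)" if "set w \<subseteq> set u \<union> set v" for w
    using sum_list_map_eq_sum_count2[OF that, of "\<lambda>a. a"] by simp
  ultimately show ?thesis
    by simp
qed

subsection \<open>Words coding the increments of a rotation\<close>

text \<open>In a chain a maximal element is greatest and a minimal one least. This later collapses
  finitely many conditions on a position into a single one.\<close>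

lemma finite_chain_Union_Inter_mem:
  fixes C :: "'a set set"
  assumes "finite C" "C \<noteq> {}" and chain: "\<And>X Y. X \<in> C \<Longrightarrow> Y \<in> C \<Longrightarrow> X \<subseteq> Y \<or> Y \<subseteq> X"
  shows "\<Union>C \<in> C" "\<Inter>C \<in> C"
proof -
  obtain M where M: "M \<in> C" "\<And>X. X \<in> C \<Longrightarrow> M \<subseteq> X \<Longrightarrow> M = X"
    using finite_has_maximal[OF assms(1,2)] by metis
  have "\<Union>C = M"
    using M chain by blast
  then show "\<Union>C \<in> C"
    using M(1) by simp
  obtain N where N: "N \<in> C" "\<And>X. X \<in> C \<Longrightarrow> X \<subseteq> N \<Longrightarrow> N = X"
    using finite_has_minimal[OF assms(1,2)] by metis
  have "\<Inter>C = N"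
    using N chain by blast
  then show "\<Inter>C \<in> C"
    using N(1) by simp
qed

text \<open>\<open>T i\<close> plays the role of \<open>\<lfloor>x + i \<alpha>\<rfloor>\<close> and \<open>H i\<close> that of \<open>{x + i \<alpha>}\<close>;
  the axioms hold for the ceiling as well.\<close>

locale rotation_coding =
  fixes s :: "nat \<Rightarrow> nat" and T :: "nat \<Rightarrow> int" and c :: int and d :: "nat \<Rightarrow> int"
    and H :: "nat \<Rightarrow> real"
  assumes letter: "int (s i) = T (Suc i) - T i - c"
    and two_valued: "T (i + j) - T i = d j \<or> T (i + j) - T i = d j + 1"
    and increment_mono: "H i \<le> H i' \<Longrightarrow> T (i + j) - T i \<le> T (i' + j) - T i'"
begin

text \<open>Letters are first differences of \<open>T\<close> up to the constant \<open>c\<close>,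
  so equal letters mean equal partial sums.\<close>

lemma factor_eq_iff:
  "map s [p..<p + l] = map s [q..<q + l] \<longleftrightarrow> (\<forall>j\<le>l. T (p + j) - T p = T (q + j) - T q)"
proof -
  have "map s [p..<p + l] = map s [q..<q + l] \<longleftrightarrow> (\<forall>j<l. s (p + j) = s (q + j))"
    by (auto simp: list_eq_iff_nth_eq)
  also have "\<dots> \<longleftrightarrow> (\<forall>j<l. int (s (p + j)) = int (s (q + j)))"
    by simp
  also have "\<dots> \<longleftrightarrow> (\<forall>j<l. T (Suc (p + j)) - T (p + j) = T (Suc (q + j)) - T (q + j))"
    by (simp add: letter)
  also have "\<dots> \<longleftrightarrow> (\<forall>j\<le>l. T (p + j) - T p = T (q + j) - T q)"
  proof (induction l)
    case (Suc l)
    \<comment> \<open>Repeating \<open>Q l\<close> puts the increments at \<open>l\<close> and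
      \<open>Suc l\<close> side by side; their difference is the new letter condition.\<close>
    have split: "(\<forall>j\<le>Suc l. Q j) \<longleftrightarrow> (\<forall>j\<le>l. Q j) \<and> Q l \<and> Q (Suc l)" for Q
      by (auto simp: le_Suc_eq)
    show ?case
      unfolding All_less_Suc Suc.IH split by (auto simp: algebra_simps)
  qed simp
  finally show ?thesis .
qed

lemma factor_eq_iff_displacement:
  "map s [p..<p + l] = map s [q..<q + l] \<longleftrightarrow> (\<forall>j\<le>l. T (p + j) - T (q + j) = T p - T q)"
proof -
  have "T (p + j) - T p = T (q + j) - T q \<longleftrightarrow> T (p + j) - T (q + j) = T p - T q" for j
    by linarith
  then show ?thesis
    by (simp only: factor_eq_iff)
qed

lemma sum_list_factor: "int (sum_list (map s [p..<p + l])) = T (p + l) - T p - c * int l"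
  by (induction l) (auto simp: letter algebra_simps)

text \<open>For the floor, these are the positions whose point lies in the arc of the circle from
  \<open>- j \<alpha>\<close> up to \<open>0\<close>.\<close>

definition level :: "nat \<Rightarrow> nat set" where
  "level j = {i. T (i + j) - T i = d j + 1}"

text \<open>Level sets are upward closed with respect to \<open>H\<close>, and up-sets of a total
  preorder are nested.\<close>

lemma level_chain: "level j \<subseteq> level j' \<or> level j' \<subseteq> level j"
proof -
  have up: "i' \<in> level j" if "i \<in> level j" "H i \<le> H i'" for i i' j
    using increment_mono[OF that(2), of j] two_valued[of i' j] that(1) by (auto simp: level_def)
  show ?thesis
    using up by (meson linear subsetI)
qed

text \<open>The difference of two such indicators has the form \<open>T (i + a) - T (i + b)\<close>
  up to a constant, whose sum over \<open>i\<close> telescopes.\<close>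

definition affine :: "nat \<Rightarrow> nat set \<Rightarrow> bool" where
  "affine l E \<longleftrightarrow> (\<exists>e a. a \<le> l \<and> (\<forall>i. of_bool (i \<in> E) = e + T (i + a) - T i))"

lemma affine_trivial: "affine l UNIV" "affine l {}"
  unfolding affine_def by (intro exI[of _ 1] exI[of _ 0]; simp) (intro exI[of _ 0]; simp)

lemma increment: "T (i + j) - T i = d j + of_bool (i \<in> level j)"
  using two_valued[of i j] by (auto simp: level_def)

lemma affine_level: "j \<le> l \<Longrightarrow> affine l (level j)"
  unfolding affine_def using increment
  by (intro exI[of _ "- d j"] exI[of _ j]) (simp add: algebra_simps)

text \<open>The level sets are nested, so the positions where a factor occurs form a difference of
  two of them: this is the interval of the circle coded by the factor.\<close>

lemma occurrence_affine:
  obtains e a b where "a \<le> l" "b \<le> l"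
    "\<And>i. of_bool (map s [i..<i + l] = map s [q..<q + l]) = e + T (i + a) - T (i + b)"
proof -
  define J where "J = {j. j \<le> l \<and> q \<in> level j}"
  define K where "K = {j. j \<le> l \<and> q \<notin> level j}"
  \<comment> \<open>\<open>UNIV\<close> and \<open>{}\<close> keep both families nonempty when
    \<open>J\<close> or \<open>K\<close> is empty, without changing the intersection or the
    union.\<close>
  define E where "E = \<Inter>(insert UNIV (level ` J))"
  define G where "G = \<Union>(insert {} (level ` K))"
  have fin: "finite J" "finite K"
    by (auto simp: J_def K_def)
  have "E \<in> insert UNIV (level ` J)"
    unfolding E_def by (rule finite_chain_Union_Inter_mem(2)) (use fin level_chain in auto)
  then have "affine l E"
    by (auto simp: J_def affine_trivial affine_level)
  then obtain e a where a: "a \<le> l" "\<And>i. of_bool (i \<in> E) = e + T (i + a) - T i"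
    by (auto simp: affine_def)
  have G_mem: "G \<in> insert {} (level ` K)"
    unfolding G_def by (rule finite_chain_Union_Inter_mem(1)) (use fin level_chain in auto)
  then have "affine l G"
    by (auto simp: K_def affine_trivial affine_level)
  then obtain e' b where b: "b \<le> l" "\<And>i. of_bool (i \<in> G) = e' + T (i + b) - T i"
    by (auto simp: affine_def)
  \<comment> \<open>\<open>q\<close> lies in \<open>X\<close> but not in \<open>G\<close>, so
    comparability leaves only this inclusion.\<close>
  have "G \<subseteq> X" if "X \<in> level ` J" for X
  proof -
    from that have "q \<in> X" by (auto simp: J_def)
    moreover have "q \<notin> G" by (auto simp: G_def K_def)
    moreover have "G \<subseteq> X \<or> X \<subseteq> G"
      using that G_mem level_chain by auto
    ultimately show ?thesis by blast
  qed
  then have "G \<subseteq> E"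
    by (auto simp: E_def)
  have occ: "map s [i..<i + l] = map s [q..<q + l] \<longleftrightarrow> i \<in> E - G" for i
    unfolding factor_eq_iff increment by (auto simp: E_def G_def J_def K_def)
  have "of_bool (map s [i..<i + l] = map s [q..<q + l]) = (e - e') + T (i + a) - T (i + b)" for i
    using a(2)[of i] b(2)[of i] \<open>G \<subseteq> E\<close> unfolding occ by (auto simp: of_bool_def split: if_splits)
  with a(1) b(1) show ?thesis by (rule that)
qed

section \<open>Telescoping of occurrence counts\<close>

lemma occurrences_factor:
  "occurrences (map s [p..<p + n]) w =
     (\<Sum>i<Suc n - length w. of_bool (map s [p + i..<p + i + length w] = w))"
proof -
  have "take (length w) (drop i (map s [p..<p + n])) = map s [p + i..<p + i + length w]"
    if "i < Suc n - length w" for i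
    using that by (auto simp: drop_map take_map)
  then show ?thesis
    by (simp add: occurrences_eq_sum)
qed

text \<open>The difference of the two counts is a difference of shifted sums of
  \<open>T (p + j) - T (q + j)\<close>. Shifting affects only terms near the two ends, where all
  values equal \<open>f\<close>.\<close>

lemma k_abelian_equiv_factorsI:
  assumes "m \<le> n"
    and front: "\<And>j. j \<le> m \<Longrightarrow> T (p + j) - T (q + j) = f"
    and rear: "\<And>j. j \<le> m \<Longrightarrow> T (p + n - j) - T (q + n - j) = f"
  shows "k_abelian_equiv (Suc m) (map s [p..<p + n]) (map s [q..<q + n])"
  unfolding k_abelian_equiv_def
proof (intro allI impI)
  fix w :: "nat list"
  assume w: "w \<noteq> [] \<and> length w \<le> Suc m"
  define l where "l = length w"
  have l: "0 < l" "l \<le> Suc m"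
    using w by (auto simp: l_def)
  show "occurrences (map s [p..<p + n]) w = occurrences (map s [q..<q + n]) w"
  proof (cases "l \<le> n \<and> (\<exists>r. w = map s [r..<r + l])")
    case False
    then consider "n < l" | "\<And>i. map s [i..<i + l] \<noteq> w"
      by force
    then show ?thesis
      by cases (auto simp: occurrences_factor simp flip: l_def)
  next
    case True
    then obtain r where r: "w = map s [r..<r + l]" and "l \<le> n" by blast
    obtain e a b where ab: "a \<le> l" "b \<le> l" and
      ind: "\<And>i. of_bool (map s [i..<i + l] = w) = e + T (i + a) - T (i + b)"
      using occurrence_affine[of l r] unfolding r by metis
    define N where "N = Suc n - l"
    define \<phi> where "\<phi> j = T (p + j) - T (q + j)" for j
    \<comment> \<open>One more shift drops the term at \<open>t\<close> and gains the one at
      \<open>N + t\<close>. Since \<open>t < l \<le> Suc m\<close>, both lie within \<open>m\<close>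
      of an end.\<close>
    have shift: "(\<Sum>i<N. \<phi> (i + t)) = (\<Sum>i<N. \<phi> i)" if "t \<le> l" for t
      using that
    proof (induction t)
      case (Suc t)
      have "(\<Sum>i<N. \<phi> (i + Suc t)) - (\<Sum>i<N. \<phi> (i + t)) = \<phi> (N + t) - \<phi> t"
        using sum_lessThan_telescope[of "\<lambda>i. \<phi> (i + t)" N] by (simp add: sum_subtractf)
      moreover have "\<phi> t = f"
        using front[of t] Suc.prems l by (simp add: \<phi>_def)
      moreover have "\<phi> (N + t) = f"
      proof -
        have "N + t = n - (l - Suc t)" "l - Suc t \<le> m" "l - Suc t \<le> n"
          using Suc.prems l \<open>l \<le> n\<close> by (auto simp: N_def)
        then show ?thesis
          using rear[of "l - Suc t"] by (simp add: \<phi>_def)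
      qed
      ultimately show ?case
        using Suc by simp
    qed simp
    have count: "int (occurrences (map s [o'..<o' + n]) w) =
        (\<Sum>i<N. e + T (o' + (i + a)) - T (o' + (i + b)))" for o'
      unfolding occurrences_factor of_nat_sum of_nat_of_bool l_def[symmetric] N_def ind
      by (simp add: add.assoc)
    have "int (occurrences (map s [p..<p + n]) w) - int (occurrences (map s [q..<q + n]) w) =
        (\<Sum>i<N. \<phi> (i + a)) - (\<Sum>i<N. \<phi> (i + b))"
      unfolding count \<phi>_def by (simp flip: sum_subtractf) (simp add: algebra_simps)
    then show ?thesis
      using shift ab by simp
  qed
qed

section \<open>Common ends and abelian class in terms of \<open>T\<close>\<close>

lemma factor_prefix_iff:
  assumes "m \<le> n"
  shows "take m (map s [p..<p + n]) = take m (map s [q..<q + n]) \<longleftrightarrow>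
    (\<forall>j\<le>m. T (p + j) - T (q + j) = T p - T q)"
proof -
  have "take m (map s [o'..<o' + n]) = map s [o'..<o' + m]" for o'
    using assms by (simp add: take_map)
  then show ?thesis
    by (simp only: factor_eq_iff_displacement)
qed

text \<open>Offsets count backwards from the end, so that the constant displacement is its value at
  \<open>n\<close>, the one relevant to abelian equivalence.\<close>

lemma factor_suffix_iff:
  assumes "m \<le> n"
  shows "drop (n - m) (map s [p..<p + n]) = drop (n - m) (map s [q..<q + n]) \<longleftrightarrow>
    (\<forall>j\<le>m. T (p + n - j) - T (q + n - j) = T (p + n) - T (q + n))"
proof -
  define \<phi> where "\<phi> j = T (p + j) - T (q + j)" for j
  have "drop (n - m) (map s [o'..<o' + n]) = map s [o' + (n - m)..<o' + (n - m) + m]" for o'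
    using assms by (simp add: drop_map)
  then have "drop (n - m) (map s [p..<p + n]) = drop (n - m) (map s [q..<q + n]) \<longleftrightarrow>
      (\<forall>j\<le>m. \<phi> (n - m + j) = \<phi> (n - m))"
    by (simp only: factor_eq_iff_displacement) (simp only: \<phi>_def add.assoc)
  also have "\<dots> \<longleftrightarrow> (\<forall>j\<le>m. \<phi> (n - j) = \<phi> n)" (is "?L \<longleftrightarrow> ?R")
  proof
    assume L: ?L
    show ?R
    proof (intro allI impI)
      fix j assume "j \<le> m"
      then show "\<phi> (n - j) = \<phi> n"
        using L[rule_format, of "m - j"] L[rule_format, of m] assms by simp
    qed
  next
    assume R: ?R
    show ?L
    proof (intro allI impI)
      fix j assume "j \<le> m"
      then show "\<phi> (n - m + j) = \<phi> (n - m)"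
        using R[rule_format, of "m - j"] R[rule_format, of m] assms by simp
    qed
  qed
  also have "\<dots> \<longleftrightarrow> (\<forall>j\<le>m. T (p + n - j) - T (q + n - j) = T (p + n) - T (q + n))"
    using assms by (simp add: \<phi>_def)
  finally show ?thesis .
qed

text \<open>For \<open>m = 0\<close> both ends are empty and this is the criterion for abelian
  equivalence.\<close>

lemma k_abelian_equiv_factors_iff:
  fixes p q :: nat
  assumes "m \<le> n"
  defines "u \<equiv> map s [p..<p + n]" and "v \<equiv> map s [q..<q + n]"
  shows "k_abelian_equiv (Suc m) u v \<longleftrightarrow>
    take m u = take m v \<and> drop (n - m) u = drop (n - m) v \<and> T (p + n) - T (q + n) = T p - T q"
proof
  assume eq: "k_abelian_equiv (Suc m) u v"
  have len: "length u = n" "length v = n"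
    by (auto simp: u_def v_def)
  have "sum_list u = sum_list v"
    using eq len by (intro k_abelian_equiv_imp_sum_list_eq[of "Suc m"]) auto
  then have "T (p + n) - T p = T (q + n) - T q"
    using sum_list_factor[of p n] sum_list_factor[of q n] by (simp add: u_def v_def)
  then show "take m u = take m v \<and> drop (n - m) u = drop (n - m) v \<and> T (p + n) - T (q + n) = T p - T q"
    using k_abelian_equiv_imp_ends[OF eq] len assms(1) by simp
next
  assume "take m u = take m v \<and> drop (n - m) u = drop (n - m) v \<and> T (p + n) - T (q + n) = T p - T q"
  then show "k_abelian_equiv (Suc m) u v"
    using assms(1) unfolding u_def v_def factor_prefix_iff[OF assms(1)] factor_suffix_iff[OF assms(1)]
    by (intro k_abelian_equiv_factorsI[where f = "T p - T q"]) auto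
qed

end

subsection \<open>Sturmian words\<close>

lemma frac_one_minus: "\<alpha> \<notin> \<rat> \<Longrightarrow> frac (1 - \<alpha>) = 1 - frac \<alpha>"
  using frac_1_eq[of "- \<alpha>"] frac_neg[of \<alpha>] Ints_subset_Rats by auto

text \<open>An increment of the floor exceeds \<open>d j\<close> by the carry of the fractional
  parts, which is 0 or 1 and monotone in \<open>H i\<close>.\<close>

lemma rotation_coding_lower:
  "rotation_coding (sturmian_lower \<alpha> x) (\<lambda>i. \<lfloor>x + real i * \<alpha>\<rfloor>) \<lfloor>\<alpha>\<rfloor>
     (\<lambda>j. \<lfloor>real j * \<alpha>\<rfloor>) (\<lambda>i. frac (x + real i * \<alpha>))"
  if "\<alpha> \<notin> \<rat>"
proof
  have Suc: "x + real (Suc i) * \<alpha> = (x + real i * \<alpha>) + \<alpha>" for i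
    by (simp add: algebra_simps)
  have split: "x + real (i + j) * \<alpha> = (x + real i * \<alpha>) + real j * \<alpha>" for i j
    by (simp add: algebra_simps)
  note frac = frac_one_minus[OF that]
  have step: "(if frac z \<in> {0..<1 - frac \<alpha>} then 0 else 1) = \<lfloor>z + \<alpha>\<rfloor> - \<lfloor>z\<rfloor> - \<lfloor>\<alpha>\<rfloor>" for z
    by (auto simp: floor_add)
  show "int (sturmian_lower \<alpha> x i) = \<lfloor>x + real (Suc i) * \<alpha>\<rfloor> - \<lfloor>x + real i * \<alpha>\<rfloor> - \<lfloor>\<alpha>\<rfloor>" for i
    unfolding Suc step[symmetric] by (simp add: sturmian_lower_def frac)
  show "\<lfloor>x + real (i + j) * \<alpha>\<rfloor> - \<lfloor>x + real i * \<alpha>\<rfloor> = \<lfloor>real j * \<alpha>\<rfloor> \<or>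
        \<lfloor>x + real (i + j) * \<alpha>\<rfloor> - \<lfloor>x + real i * \<alpha>\<rfloor> = \<lfloor>real j * \<alpha>\<rfloor> + 1" for i j
    unfolding split by (auto simp: floor_add)
  show "\<lfloor>x + real (i + j) * \<alpha>\<rfloor> - \<lfloor>x + real i * \<alpha>\<rfloor> \<le> \<lfloor>x + real (i' + j) * \<alpha>\<rfloor> - \<lfloor>x + real i' * \<alpha>\<rfloor>"
    if "frac (x + real i * \<alpha>) \<le> frac (x + real i' * \<alpha>)" for i i' j
    using that unfolding split by (auto simp: floor_add)
qed

text \<open>Here \<open>H\<close> takes values in \<open>(-1, 0]\<close>, matching the circle
  \<open>(0, 1]\<close>; subadditivity of the ceiling makes
  \<open>\<lceil>j \<alpha>\<rceil>\<close> the larger increment.\<close>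

lemma rotation_coding_upper:
  "rotation_coding (sturmian_upper \<alpha> x) (\<lambda>i. \<lceil>x + real i * \<alpha>\<rceil>) \<lfloor>\<alpha>\<rfloor>
     (\<lambda>j. \<lceil>real j * \<alpha>\<rceil> - 1) (\<lambda>i. x + real i * \<alpha> - \<lceil>x + real i * \<alpha>\<rceil>)"
  if "\<alpha> \<notin> \<rat>"
proof
  have Suc: "x + real (Suc i) * \<alpha> = (x + real i * \<alpha>) + \<alpha>" for i
    by (simp add: algebra_simps)
  have split: "x + real (i + j) * \<alpha> = (x + real i * \<alpha>) + real j * \<alpha>" for i j
    by (simp add: algebra_simps)
  note frac = frac_one_minus[OF that]
  have \<alpha>: "\<lfloor>\<alpha>\<rfloor> < \<alpha>" "\<alpha> < \<lfloor>\<alpha>\<rfloor> + 1"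
    using that Ints_subset_Rats frac_gt_0_iff[of \<alpha>] by (auto simp: frac_def)
  have step: "(if frac z \<in> {0<..1 - frac \<alpha>} then 0 else 1) = \<lceil>z + \<alpha>\<rceil> - \<lceil>z\<rceil> - \<lfloor>\<alpha>\<rfloor>" for z
  proof -
    have z: "\<lfloor>z\<rfloor> \<le> z" "z < \<lfloor>z\<rfloor> + 1"
      by linarith+
    \<comment> \<open>An integer \<open>z\<close> stands for the end point 1 and has letter 1; the
      other two cases are letters 0 and 1.\<close>
    consider "z = \<lfloor>z\<rfloor>" | "\<lfloor>z\<rfloor> < z" "z + \<alpha> \<le> \<lfloor>z\<rfloor> + \<lfloor>\<alpha>\<rfloor> + 1"
      | "\<lfloor>z\<rfloor> < z" "\<lfloor>z\<rfloor> + \<lfloor>\<alpha>\<rfloor> + 1 < z + \<alpha>"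
      using z by linarith
    then show ?thesis
    proof cases
      case 1
      then have "\<lceil>z + \<alpha>\<rceil> = \<lfloor>z\<rfloor> + \<lfloor>\<alpha>\<rfloor> + 1"
        using \<alpha> by (intro ceiling_unique) auto
      with 1 show ?thesis
        by (simp add: frac_def ceiling_altdef)
    next
      case 2
      then have "\<lceil>z + \<alpha>\<rceil> = \<lfloor>z\<rfloor> + \<lfloor>\<alpha>\<rfloor> + 1"
        using \<alpha> by (intro ceiling_unique) auto
      with 2 show ?thesis
        by (simp add: frac_def ceiling_altdef[of z])
    next
      case 3
      then have "\<lceil>z + \<alpha>\<rceil> = \<lfloor>z\<rfloor> + \<lfloor>\<alpha>\<rfloor> + 2"
        using \<alpha> z by (intro ceiling_unique; linarith)
      with 3 show ?thesis
        by (simp add: frac_def ceiling_altdef[of z])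
    qed
  qed
  show "int (sturmian_upper \<alpha> x i) = \<lceil>x + real (Suc i) * \<alpha>\<rceil> - \<lceil>x + real i * \<alpha>\<rceil> - \<lfloor>\<alpha>\<rfloor>" for i
    unfolding Suc step[symmetric] by (simp add: sturmian_upper_def frac)
  show "\<lceil>x + real (i + j) * \<alpha>\<rceil> - \<lceil>x + real i * \<alpha>\<rceil> = \<lceil>real j * \<alpha>\<rceil> - 1 \<or>
        \<lceil>x + real (i + j) * \<alpha>\<rceil> - \<lceil>x + real i * \<alpha>\<rceil> = \<lceil>real j * \<alpha>\<rceil> - 1 + 1" for i j
    unfolding split by linarith
  show "\<lceil>x + real (i + j) * \<alpha>\<rceil> - \<lceil>x + real i * \<alpha>\<rceil> \<le> \<lceil>x + real (i' + j) * \<alpha>\<rceil> - \<lceil>x + real i' * \<alpha>\<rceil>"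
    if "x + real i * \<alpha> - \<lceil>x + real i * \<alpha>\<rceil> \<le> x + real i' * \<alpha> - \<lceil>x + real i' * \<alpha>\<rceil>" for i i' j
    using that unfolding split by linarith
qed

section \<open>Common ends force abelian equivalence for large \<open>m\<close>\<close>

text \<open>Two points at distance at least \<open>1/2\<close> in a unit interval are separated by an
  integer after translating by some multiple of a step of length at most \<open>1/2\<close>.\<close>

lemma floor_rotation_close_aux:
  fixes y z \<beta> :: real
  assumes \<beta>: "\<bar>\<beta>\<bar> \<le> 1/2" "real m * \<bar>\<beta>\<bar> > 1/2"
    and same: "\<And>j. j \<le> m \<Longrightarrow> \<lfloor>y + real j * \<beta>\<rfloor> = \<lfloor>z + real j * \<beta>\<rfloor>"
  shows "z - y < 1/2"
proof (rule ccontr)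
  assume far: "\<not> z - y < 1/2"
  define N where "N = \<lfloor>y\<rfloor>"
  have N: "N \<le> y" "z < N + 1"
    using same[of 0] unfolding N_def by auto linarith+
  \<comment> \<open>\<open>P j\<close> says that the leading point, \<open>z\<close> when moving
    right and \<open>y\<close> when moving left, has left the unit interval starting at
    \<open>N\<close>. The first such \<open>j\<close> is used.\<close>
  define P where "P j \<longleftrightarrow> (if \<beta> > 0 then z + real j * \<beta> \<ge> N + 1 else y + real j * \<beta> < N)" for j
  have "P m"
    using \<beta>(2) N far by (auto simp: P_def abs_if split: if_splits)
  then obtain j where j: "P j" "\<And>i. i < j \<Longrightarrow> \<not> P i"
    using exists_least_iff[of P] by blast
  have "j \<le> m"
    using j(2) \<open>P m\<close> by (meson not_le)
  have "j \<noteq> 0"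
  proof
    assume "j = 0"
    with j(1) N show False
      by (auto simp: P_def split: if_splits)
  qed
  then obtain i where i: "j = Suc i"
    using not0_implies_Suc by blast
  have "\<lfloor>y + real j * \<beta>\<rfloor> \<noteq> \<lfloor>z + real j * \<beta>\<rfloor>"
  proof (cases "\<beta> > 0")
    case True
    \<comment> \<open>The last step overshoots the boundary by less than 1/2, and the other point
      trails by at least 1/2, so it has not crossed.\<close>
    then have "z + real j * \<beta> \<ge> N + 1" "y + real j * \<beta> < N + 1"
      using j(1) j(2)[of i] far \<beta>(1) by (auto simp: P_def i algebra_simps)
    then have "\<lfloor>z + real j * \<beta>\<rfloor> \<ge> N + 1" "\<lfloor>y + real j * \<beta>\<rfloor> < N + 1"
      by (simp_all only: le_floor_iff floor_less_iff)
    then show ?thesis by linarith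
  next
    case False
    then have "y + real j * \<beta> < N" "z + real j * \<beta> \<ge> N"
      using j(1) j(2)[of i] far \<beta>(1) by (auto simp: P_def i algebra_simps)
    then have "\<lfloor>y + real j * \<beta>\<rfloor> < N" "\<lfloor>z + real j * \<beta>\<rfloor> \<ge> N"
      by (simp_all only: le_floor_iff floor_less_iff)
    then show ?thesis by linarith
  qed
  with same[OF \<open>j \<le> m\<close>] show False by blast
qed

text \<open>Reducing \<open>\<alpha>\<close> by its nearest integer shifts all values by integers
  and leaves a step of length \<open>dist_nearest_int \<alpha>\<close>. The ceiling follows from the
  floor by reflection.\<close>

lemma rotation_close:
  fixes y z \<alpha> :: real
  assumes F: "F = floor \<or> F = ceiling"
    and dist: "2 * real m * dist_nearest_int \<alpha> > 1"
    and same: "\<And>j. j \<le> m \<Longrightarrow> F (y + real j * \<alpha>) = F (z + real j * \<alpha>)"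
  shows "\<bar>y - z\<bar> < 1/2"
proof -
  define \<beta> where "\<beta> = \<alpha> - round \<alpha>"
  have \<beta>: "\<bar>\<beta>\<bar> \<le> 1/2" "real m * \<bar>\<beta>\<bar> > 1/2"
    using of_int_round_abs_le[of \<alpha>] dist
    by (auto simp: \<beta>_def dist_nearest_int_def abs_minus_commute)
  have shift: "w + real j * \<alpha> = w + real j * \<beta> + of_int (int j * round \<alpha>)" for w j
    by (simp add: \<beta>_def algebra_simps)
  have same': "F (y + real j * \<beta>) = F (z + real j * \<beta>)" if "j \<le> m" for j
    using F same[OF that] unfolding shift by (auto simp del: of_int_mult)
  from F show ?thesis
  proof
    assume "F = floor"
    then show ?thesis
      using floor_rotation_close_aux[OF \<beta>, of y z] floor_rotation_close_aux[OF \<beta>, of z y] same'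
      by (simp add: abs_if)
  next
    assume "F = ceiling"
    then have "\<lfloor>- y + real j * (- \<beta>)\<rfloor> = \<lfloor>- z + real j * (- \<beta>)\<rfloor>" if "j \<le> m" for j
      using same'[OF that] by (simp add: ceiling_def add.commute)
    then have "- z - - y < 1/2" "- y - - z < 1/2"
      using \<beta> by (intro floor_rotation_close_aux[of "- \<beta>" m]; simp)+
    then show ?thesis by linarith
  qed
qed

text \<open>The common prefix and the common suffix each confine the real number \<open>p \<alpha> - q \<alpha>\<close>
  to a distance less than \<open>1/2\<close> from an integer, so both integers coincide.\<close>

lemma rotation_same_displacement:
  fixes F :: "real \<Rightarrow> int"
  assumes F: "F = floor \<or> F = ceiling"
    and dist: "2 * real m * dist_nearest_int \<alpha> > 1"
    and T: "\<And>i. T i = F (x + real i * \<alpha>)"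
    and "m \<le> n"
    and front: "\<And>j. j \<le> m \<Longrightarrow> T (p + j) - T (q + j) = T p - T q"
    and rear: "\<And>j. j \<le> m \<Longrightarrow> T (p + n - j) - T (q + n - j) = T (p + n) - T (q + n)"
  shows "T (p + n) - T (q + n) = T p - T q"
proof -
  \<comment> \<open>Translating the orbit from \<open>q\<close> by the integer \<open>f\<close>
    makes the two codings agree. The prefix uses \<open>h = 0\<close>, the suffix
    \<open>h = n - m\<close>.\<close>
  have close: "\<bar>real p * \<alpha> - real q * \<alpha> - f\<bar> < 1/2"
    if f: "\<And>j. j \<le> m \<Longrightarrow> T (p + h + j) - T (q + h + j) = f" for h and f :: int
  proof -
    have "F (x + real (p + h) * \<alpha> + real j * \<alpha>) = F (x + real (q + h) * \<alpha> + of_int f + real j * \<alpha>)"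
      if "j \<le> m" for j
    proof -
      have "F (w + of_int f) = F w + f" for w
        using F by auto
      from this[of "x + real (q + h) * \<alpha> + real j * \<alpha>"] show ?thesis
        using f[OF that] by (simp add: T algebra_simps)
    qed
    from rotation_close[OF F dist this] show ?thesis
      by (simp add: algebra_simps)
  qed
  have "T (p + (n - m) + j) - T (q + (n - m) + j) = T (p + n) - T (q + n)" if "j \<le> m" for j
  proof -
    have "p + (n - m) + j = p + n - (m - j)" "q + (n - m) + j = q + n - (m - j)"
      using that \<open>m \<le> n\<close> by auto
    then show ?thesis
      using rear[of "m - j"] by simp
  qed
  note close[OF this]
  moreover have "\<bar>real p * \<alpha> - real q * \<alpha> - (T p - T q)\<bar> < 1/2"
    using close[of 0 "T p - T q"] front by simp
  ultimately have "\<bar>real_of_int ((T (p + n) - T (q + n)) - (T p - T q))\<bar> < 1"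
    unfolding of_int_diff by linarith
  then show ?thesis by linarith
qed

lemma sturmian_word_coding:
  assumes "sturmian_word \<alpha> s"
  obtains F x c d H where "F = floor \<or> F = ceiling"
    "rotation_coding s (\<lambda>i. F (x + real i * \<alpha>)) c d H"
proof -
  from assms obtain x where "\<alpha> \<notin> \<rat>" "s = sturmian_lower \<alpha> x \<or> s = sturmian_upper \<alpha> x"
    by (auto simp: sturmian_word_def)
  with rotation_coding_lower[of \<alpha> x] rotation_coding_upper[of \<alpha> x] show ?thesis
    using that[of floor] that[of ceiling] by blast
qed

theorem theorem3p6:
  fixes \<alpha> :: real and k :: nat and s :: "nat \<Rightarrow> nat" and u v :: "nat list"
  assumes "\<alpha> \<notin> \<rat>"
    and "k \<ge> 1"
    and "sturmian_word \<alpha> s"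
    and "factor_of u s"
    and "factor_of v s"
    and "length u = length v"
  shows "(k_abelian_equiv k u v \<longleftrightarrow>
            share_prefix (min (length u) (k - 1)) u v \<and>
            share_suffix (min (length u) (k - 1)) u v \<and>
            k_abelian_equiv 1 u v) \<and>
         (2 * (real k - 1) * dist_nearest_int \<alpha> > 1 \<longrightarrow>
           (k_abelian_equiv k u v \<longleftrightarrow>
              share_prefix (min (length u) (k - 1)) u v \<and>
              share_suffix (min (length u) (k - 1)) u v))"
proof -
  define n where "n = length u"
  have n: "length u = n" "length v = n"
    using assms(6) by (simp_all add: n_def)
  then obtain p q where u: "u = map s [p..<p + n]" and v: "v = map s [q..<q + n]"
    using assms(4,5) by (auto simp: factor_of_def)
  obtain m where k: "k = Suc m"
    using assms(2) by (metis Suc_le_D One_nat_def)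
  show ?thesis
  proof (cases "n \<le> m")
    \<comment> \<open>The required ends are the whole words, so every condition reduces to
      \<open>u = v\<close>.\<close>
    case True
    then have "k_abelian_equiv k u v \<longleftrightarrow> u = v"
      using k_abelian_equiv_imp_eq[of k u v] n k by (auto simp: k_abelian_equiv_def)
    moreover have "share_prefix n u v \<longleftrightarrow> u = v" "share_suffix n u v \<longleftrightarrow> u = v"
      using n by (simp_all add: share_prefix_iff share_suffix_iff)
    moreover have "k_abelian_equiv 1 u u"
      by (simp add: k_abelian_equiv_def)
    ultimately show ?thesis
      using True by (auto simp: n k min_def)
  next
    case False
    then have "m \<le> n" by simp
    obtain F x c d H where F: "F = floor \<or> F = ceiling"
      and coding: "rotation_coding s (\<lambda>i. F (x + real i * \<alpha>)) c d H"
      using sturmian_word_coding[OF assms(3)] by blast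
    define T where "T i = F (x + real i * \<alpha>)" for i
    interpret rotation_coding s T c d H
      using coding unfolding T_def .
    let ?ends = "take m u = take m v \<and> drop (n - m) u = drop (n - m) v"
    have ends: "share_prefix (min (length u) (k - 1)) u v \<and>
        share_suffix (min (length u) (k - 1)) u v \<longleftrightarrow> ?ends"
      using \<open>m \<le> n\<close> n by (simp add: k share_prefix_iff share_suffix_iff min_def)
    have equiv: "k_abelian_equiv k u v \<longleftrightarrow> ?ends \<and> T (p + n) - T (q + n) = T p - T q"
      using k_abelian_equiv_factors_iff[OF \<open>m \<le> n\<close>, of p q] by (simp add: k u v)
    have abelian: "k_abelian_equiv 1 u v \<longleftrightarrow> T (p + n) - T (q + n) = T p - T q"
      using k_abelian_equiv_factors_iff[of 0 n p q] by (simp add: u v)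
    have "T (p + n) - T (q + n) = T p - T q"
      if "2 * (real k - 1) * dist_nearest_int \<alpha> > 1" ?ends
    proof -
      have "2 * real m * dist_nearest_int \<alpha> > 1"
        using that(1) by (simp add: k)
      then show ?thesis
        using that(2) unfolding u v factor_prefix_iff[OF \<open>m \<le> n\<close>] factor_suffix_iff[OF \<open>m \<le> n\<close>]
        by (intro rotation_same_displacement[OF F _ T_def \<open>m \<le> n\<close>]) auto
    qed
    with equiv abelian ends show ?thesis by blast
  qed
qed

end
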